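(* Let $\mu_1,\ldots,\mu_n$ be a collection of $n$ continuous probability measures on the unit square $I^2=[0,1]^2$. Then for any choice of integers $m_1,m_2\geq 0$ such that $m_1+m_2=n$, there exist $m_1$ vertical and $m_2$ horizontal cuts of the square, and a coloring of the elementary rectangles obtained this way by two colors "$+$" and "$-$", such that $$\mu_i(A_+)=\mu_i(A_-)=\tfrac12\quad\text{for all } i=1,\ldots,n,$$ where $A_+$ (respectively $A_-$) is the union of all elementary rectangles colored by "$+$" (respectively "$-$").
   Context: A choice of $m_1$ vertical and $m_2$ horizontal cuts is a choice of points $0=x_0\leq x_1\leq\cdots\leq x_{m_1}\leq x_{m_1+1}=1$ on the $x$-axis and $0=y_0\leq y_1\leq\cdots\leq y_{m_2}\leq y_{m_2+1}=1$ on the $y$-axis; the cuts are the lines $x=x_i$ ($1\le i\le m_1$) and $y=y_j$ ($1\le j\le m_2$). The elementary rectangles are the (possibly degenerate) rectangles $[x_i,x_{i+1}]\times[y_j,y_{j+1}]$ for $0\leq i\leq m_1$, $0\leq j\leq m_2$; a coloring is a function $\{0,\ldots,m_1\}\times\{0,\ldots,m_2\}\to\{+,-\}$. A probability measure on $I^2$ is called continuous if it is given by a density function with respect to Lebesgue measure. *)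

theory Defs
  imports "HOL-Probability.Probability"
begin

definition unit_square :: "(real \<times> real) set" where
  "unit_square = {0..1} \<times> {0..1}"

text \<open>
  Here ``continuous'' means absolutely continuous: the measure has a density with respect to
  Lebesgue measure. Measures live on the Borel subsets of the unit square.
\<close>

definition continuous_prob_measure :: "(real \<times> real) measure \<Rightarrow> bool" where
  "continuous_prob_measure M \<longleftrightarrow>
     prob_space M \<and>
     (\<exists>f \<in> borel_measurable (restrict_space lborel unit_square).
        M = density (restrict_space lborel unit_square) f)"

definition cut_points :: "nat \<Rightarrow> (nat \<Rightarrow> real) \<Rightarrow> bool" where
  "cut_points m x \<longleftrightarrow> x 0 = 0 \<and> x (m + 1) = 1 \<and> (\<forall>i \<le> m. x i \<le> x (i + 1))"

definition elementary_rectangle ::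
  "(nat \<Rightarrow> real) \<Rightarrow> (nat \<Rightarrow> real) \<Rightarrow> nat \<Rightarrow> nat \<Rightarrow> (real \<times> real) set" where
  "elementary_rectangle x y i j = {x i..x (i + 1)} \<times> {y j..y (j + 1)}"

datatype color = Plus | Minus

text \<open>
  A coloring is a total function on pairs of naturals, but only its values at the index pairs
  of the elementary rectangles are used.
\<close>

definition colored_region ::
  "nat \<Rightarrow> nat \<Rightarrow> (nat \<Rightarrow> real) \<Rightarrow> (nat \<Rightarrow> real) \<Rightarrow> (nat \<times> nat \<Rightarrow> color) \<Rightarrow> color
     \<Rightarrow> (real \<times> real) set" where
  "colored_region m1 m2 x y col a =
     (\<Union>(i, j) \<in> {p \<in> {0..m1} \<times> {0..m2}. col p = a}. elementary_rectangle x y i j)"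

end

theory Submission
  imports Defs "HOL-Homology.Simplices"
begin

text \<open>
  A point \<open>z\<close> of the unit sphere of the \<open>l\<^sup>1\<close>-norm on \<open>\<real>\<^bsup>n+1\<^esup>\<close> describes a division of the square
  into \<open>n + 1\<close> boxes: the last \<open>m2\<close> coordinates give the heights of full-width horizontal strips, and
  the bottom strip that remains, of height \<open>h = |z 0| + \<dots> + |z m1|\<close>, is divided by vertical cuts into
  boxes of widths \<open>|z k| / h\<close>. The \<open>k\<close>-th box is coloured by the sign of \<open>z k\<close>. This uses \<open>m1\<close>
  vertical and \<open>m2\<close> horizontal cuts, and \<open>\<mu> i (A\<^sub>+) - \<mu> i (A\<^sub>-)\<close> is an odd continuous function of \<open>z\<close>, so
  the Borsuk--Ulam theorem yields the colouring.

  The Borsuk--Ulam theorem is obtained from Ky Fan's counting argument. Let \<open>c k\<close> be the singular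
  \<open>k\<close>-chain of a hemisphere, so that \<open>\<partial> (c (k + 1)) = c k \<plusminus> T (c k)\<close> for the antipodal map \<open>T\<close>. Label
  points antipodally by \<open>\<plusminus>i\<close>. If the chains are subdivided until no simplex carries complementary
  labels, then the parity of the number of simplices of \<open>c k\<close> with alternating labels does not depend
  on \<open>k\<close>, hence is odd; but an alternating \<open>n\<close>-simplex needs \<open>n + 1\<close> labels of different absolute value.
\<close>

subsection \<open>Alternating label sequences\<close>

primrec alternating :: "bool \<Rightarrow> nat list \<Rightarrow> bool" where
  "alternating s [] \<longleftrightarrow> True"
| "alternating s (x # xs) \<longleftrightarrow> even x = s \<and> alternating (\<not> s) xs"

definition del_nth :: "nat \<Rightarrow> 'a list \<Rightarrow> 'a list" where
  "del_nth k xs = take k xs @ drop (Suc k) xs"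

text \<open>The combinatorial core of the counting argument: modulo 2, the alternating facets of a
  simplex detect whether the simplex itself alternates. Deleting the head leaves \<open>xs\<close>;
  every later deletion keeps the head and so contributes only if the head has sign \<open>s\<close>.
  If it has, the induction hypothesis for the opposite sign applies; otherwise the two surviving
  terms are equal.\<close>

lemma alternating_del_nth_parity:
  "even ((\<Sum>k<length xs. of_bool (alternating s (del_nth k xs)))
     + of_bool (alternating s xs) + of_bool (alternating (\<not> s) xs) :: int)"
proof (induction xs arbitrary: s)
  case (Cons x xs)
  have "(\<Sum>k<length (x # xs). of_bool (alternating s (del_nth k (x # xs)))) =
     of_bool (alternating s xs) +
     of_bool (even x = s) * (\<Sum>k<length xs. of_bool (alternating (\<not> s) (del_nth k xs)) :: int)"
    unfolding length_Cons sum.lessThan_Suc_shift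
    by (simp add: del_nth_def sum_distrib_left)
  then show ?case
    using Cons.IH[of "\<not> s"] by (cases "even x = s") auto
qed (auto simp: del_nth_def)

lemma mset_del_nth: "k < length xs \<Longrightarrow> mset (del_nth k xs) = mset xs - {#xs ! k#}"
  unfolding del_nth_def
  by (metis add_mset_remove_trivial id_take_nth_drop mset.simps(2) mset_append union_mset_add_mset_right)

lemma sum_nth_eq_sum_mset: "(\<Sum>k<length xs. g (xs ! k)) = sum_mset (image_mset g (mset xs))"
proof -
  have "sum_mset (image_mset g (mset xs)) = sum_list (map g xs)"
    by (metis mset_map sum_mset_sum_list)
  then show ?thesis
    by (simp add: sum_list_sum_nth atLeast0LessThan)
qed

lemma sorted_del_nth:
  assumes "sorted xs"
  shows "sorted (del_nth k xs)"
proof -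
  have "sorted (take k xs @ drop k xs)"
    using assms by simp
  then show ?thesis
    unfolding del_nth_def sorted_append using assms set_drop_subset_set_drop[of k "Suc k" xs]
    by (auto simp: sorted_wrt_drop)
qed

text \<open>A sorted list depends only on its multiset, and both sides sum over the same multiset of
  possible deletions. Hence faces may be counted as if the vertex labels were already in
  order.\<close>

lemma sum_sort_del_nth:
  fixes h :: "'a::linorder list \<Rightarrow> int"
  shows "(\<Sum>k<length xs. h (sort (del_nth k xs))) = (\<Sum>k<length xs. h (del_nth k (sort xs)))"
proof -
  define H where "H M = h (sorted_list_of_multiset M)" for M
  have sort_eq: "h (sort ys) = H (mset ys)" for ys
    by (simp add: H_def)
  have "(\<Sum>k<length xs. h (sort (del_nth k xs))) = (\<Sum>k<length xs. H (mset xs - {#xs ! k#}))"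
    by (simp add: sort_eq mset_del_nth)
  also have "\<dots> = (\<Sum>k<length (sort xs). H (mset (sort xs) - {#sort xs ! k#}))"
    using sum_nth_eq_sum_mset[of "\<lambda>x. H (mset xs - {#x#})" xs]
      sum_nth_eq_sum_mset[of "\<lambda>x. H (mset xs - {#x#})" "sort xs"] by simp
  also have "\<dots> = (\<Sum>k<length (sort xs). h (del_nth k (sort xs)))"
  proof (intro sum.cong refl)
    fix k assume "k \<in> {..<length (sort xs)}"
    then have "H (mset (sort xs) - {#sort xs ! k#}) = h (sort (del_nth k (sort xs)))"
      by (simp only: sort_eq mset_del_nth lessThan_iff)
    also have "sort (del_nth k (sort xs)) = del_nth k (sort xs)"
      by (intro sort_key_id_if_sorted) (simp add: sorted_del_nth)
    finally show "H (mset (sort xs) - {#sort xs ! k#}) = h (del_nth k (sort xs))" .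
  qed
  finally show ?thesis by simp
qed

text \<open>
  The labels \<open>+i\<close> and \<open>-i\<close> are encoded as \<open>2 * i\<close> and \<open>2 * i + 1\<close>, so that the order of the natural
  numbers sorts labels by absolute value and parity is the sign.
\<close>

definition opp :: "nat \<Rightarrow> nat" where
  "opp a = (if even a then Suc a else a - 1)"

definition compatible :: "nat set \<Rightarrow> bool" where
  "compatible A \<longleftrightarrow> (\<forall>a\<in>A. opp a \<notin> A)"

lemma even_opp [simp]: "even (opp a) \<longleftrightarrow> odd a"
  by (auto simp: opp_def)

lemma opp_div_2: "opp a div 2 = a div 2"
  unfolding opp_def by presburger

lemma alternating_map_opp: "alternating s (map opp xs) = alternating (\<not> s) xs"
  by (induction xs arbitrary: s) auto

text \<open>The map \<open>opp\<close> only swaps the neighbours \<open>2 * i\<close> and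
  \<open>2 * i + 1\<close>, so the sole order it can reverse is that of a complementary pair.
  Without such pairs it is monotone on the entries.\<close>

lemma sort_map_opp:
  assumes "compatible (set xs)"
  shows "sort (map opp xs) = map opp (sort xs)"
proof -
  have mono: "opp a \<le> opp b" if "a \<in> set xs" "b \<in> set xs" "a \<le> b" for a b
  proof (cases "a = b")
    case False
    with that have "a < b" by simp
    moreover have "\<not> (even a \<and> b = Suc a)"
      using that assms unfolding compatible_def by (metis opp_def)
    ultimately show ?thesis
      unfolding opp_def by presburger
  qed auto
  have "sorted (map opp (sort xs))"
    unfolding sorted_map
    by (rule sorted_wrt_mono_rel[of _ "(\<le>)"]) (auto simp: mono)
  then show ?thesis
    by (metis mset_map mset_sort properties_for_sort)
qed

text \<open>Neighbouring entries have different signs, and compatibility forbids that they share an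
  absolute value. The absolute values \<open>a div 2\<close> therefore increase strictly inside a
  set of size \<open>n\<close>.\<close>

lemma length_alternating_le:
  assumes "sorted xs" "alternating s xs" "compatible (set xs)" "set xs \<subseteq> {..<2 * n}"
  shows "length xs \<le> n"
proof -
  have "sorted_wrt (\<lambda>a b. a div 2 < b div 2) xs"
    using assms(1-3)
  proof (induction xs arbitrary: s)
    case (Cons x xs)
    show ?case
    proof (cases xs)
      case (Cons y ys)
      have comp: "compatible (set xs)"
        using Cons.prems(3) by (auto simp: compatible_def)
      have xy: "x \<le> y" "even x \<noteq> even y"
        using Cons.prems \<open>xs = y # ys\<close> by auto
      have "\<not> (even x \<and> y = Suc x)"
        using Cons.prems(3) \<open>xs = y # ys\<close> unfolding compatible_def opp_def by auto
      then have "x div 2 < y div 2"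
        using xy by presburger
      moreover have "y div 2 \<le> z div 2" if "z \<in> set xs" for z
        using Cons.prems(1) that \<open>xs = y # ys\<close> by (auto intro!: div_le_mono)
      moreover have "sorted_wrt (\<lambda>a b. a div 2 < b div 2) xs"
        using Cons.IH[of "\<not> s"] Cons.prems comp by auto
      ultimately show ?thesis by fastforce
    qed auto
  qed auto
  then have "sorted_wrt (<) (map (\<lambda>a. a div 2) xs)"
    by (simp add: sorted_wrt_map)
  then have "distinct (map (\<lambda>a. a div 2) xs)"
    using strict_sorted_iff by blast
  then have "length xs = card ((\<lambda>a. a div 2) ` set xs)"
    by (metis distinct_card length_map set_map)
  also have "\<dots> \<le> card {..<n}"
    using assms(4) by (intro card_mono) auto
  finally show ?thesis by simp
qed

subsection \<open>Counting alternating simplices of a singular chain\<close>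

text \<open>The additive extension of the weight \<open>w\<close> from simplices to chains. The
  target is the free abelian group on the one element \<open>()\<close>, a copy of the integers, so
  that the library of \<open>frag_extend\<close> applies.\<close>

definition chain_eval :: "('a \<Rightarrow> int) \<Rightarrow> ('a \<Rightarrow>\<^sub>0 int) \<Rightarrow> int" where
  "chain_eval w c = poly_mapping.lookup (frag_extend (\<lambda>f. frag_cmul (w f) (frag_of ())) c) ()"

lemma chain_eval_simps [simp]:
  "chain_eval w 0 = 0"
  "chain_eval w (frag_of f) = w f"
  "chain_eval w (a + b) = chain_eval w a + chain_eval w b"
  "chain_eval w (a - b) = chain_eval w a - chain_eval w b"
  "chain_eval w (frag_cmul m a) = m * chain_eval w a"
  by (simp_all add: chain_eval_def frag_extend_add frag_extend_diff lookup_add lookup_minus frag_extend_cmul)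

lemma chain_eval_sum: "chain_eval w (sum g I) = (\<Sum>i\<in>I. chain_eval w (g i))"
  by (induction I rule: infinite_finite_induct) auto

lemma chain_eval_nonzero: 
  assumes "chain_eval w c \<noteq> 0" 
  obtains f where "f \<in> Poly_Mapping.keys c" "w f \<noteq> 0"
proof -
  have "\<exists>f\<in>Poly_Mapping.keys c. w f \<noteq> 0"
  proof (rule ccontr)
    assume "\<not> ?thesis"
    then have "frag_extend (\<lambda>f. frag_cmul (w f) (frag_of ())) c = 0"
      by (intro frag_extend_eq_0) auto
    then show False using assms by (simp add: chain_eval_def)
  qed
  then show ?thesis using that by blast
qed

definition vertex_labels :: "('a \<Rightarrow> nat) \<Rightarrow> nat \<Rightarrow> ((nat \<Rightarrow> real) \<Rightarrow> 'a) \<Rightarrow> nat list" where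
  "vertex_labels lam p f = map (\<lambda>i. lam (simplicial_vertex i f)) [0..<Suc p]"

definition fan_weight :: "('a \<Rightarrow> nat) \<Rightarrow> bool \<Rightarrow> nat \<Rightarrow> ((nat \<Rightarrow> real) \<Rightarrow> 'a) \<Rightarrow> int" where
  "fan_weight lam s p f = of_bool (alternating s (sort (vertex_labels lam p f)))"

lemma length_vertex_labels [simp]: "length (vertex_labels lam p f) = Suc p"
  by (simp add: vertex_labels_def)

lemma simplicial_vertex_singular_face:
  assumes "1 \<le> p" "k \<le> p" "i < p"
  shows "simplicial_vertex i (singular_face p k f) = simplicial_vertex (if i < k then i else Suc i) f"
proof -
  have "simplical_face k (\<lambda>j. if j = i then 1 else 0) = 
    (\<lambda>j. if j = (if i < k then i else Suc i) then 1 else 0 :: real)"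
    by (auto simp: simplical_face_def fun_eq_iff)
  moreover have "(\<lambda>j. if j = i then 1 else 0 :: real) \<in> standard_simplex (p - Suc 0)"
    using assms by simp
  ultimately show ?thesis
    by (simp add: simplicial_vertex_def singular_face_def)
qed

lemma vertex_labels_singular_face:
  assumes "k \<le> Suc p"
  shows "vertex_labels lam p (singular_face (Suc p) k f) = del_nth k (vertex_labels lam (Suc p) f)"
proof (rule nth_equalityI)
  fix i assume "i < length (vertex_labels lam p (singular_face (Suc p) k f))"
  then have i: "i < Suc p" by simp
  show "vertex_labels lam p (singular_face (Suc p) k f) ! i = del_nth k (vertex_labels lam (Suc p) f) ! i"
    using i assms unfolding vertex_labels_def
    by (auto simp del: upt_Suc simp: del_nth_def nth_append simplicial_vertex_singular_face)
qed (use assms in \<open>simp add: del_nth_def\<close>)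

text \<open>For a single simplex this is the parity of alternating deletions, since the faces delete
  one vertex label each and the signs of the boundary vanish modulo 2. Additivity extends it to
  chains.\<close>

lemma fan_weight_boundary_parity:
  "even (chain_eval (fan_weight lam s p) (chain_boundary (Suc p) c)
     + chain_eval (fan_weight lam s (Suc p)) c + chain_eval (fan_weight lam (\<not> s) (Suc p)) c)"
  using subset_UNIV
proof (induction c rule: frag_induction)
  case (one f)
  let ?L = "vertex_labels lam (Suc p) f"
  let ?S = "\<Sum>k\<le>Suc p. fan_weight lam s p (singular_face (Suc p) k f)"
  have "?S = (\<Sum>k<length ?L. of_bool (alternating s (sort (del_nth k ?L))))"
    unfolding length_vertex_labels lessThan_Suc_atMost
    by (intro sum.cong) (auto simp: fan_weight_def vertex_labels_singular_face)
  also have "\<dots> = (\<Sum>k<length ?L. of_bool (alternating s (del_nth k (sort ?L))))"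
    by (rule sum_sort_del_nth)
  finally have S: "even (?S + fan_weight lam s (Suc p) f + fan_weight lam (\<not> s) (Suc p) f)"
    using alternating_del_nth_parity[of s "sort ?L"] by (simp add: fan_weight_def)
  have "chain_eval (fan_weight lam s p) (chain_boundary (Suc p) (frag_of f))
     = (\<Sum>k\<le>Suc p. (-1) ^ k * fan_weight lam s p (singular_face (Suc p) k f))"
    by (simp add: chain_boundary_of chain_eval_sum del: sum.atMost_Suc)
  moreover have "even ((\<Sum>k\<le>Suc p. (-1) ^ k * fan_weight lam s p (singular_face (Suc p) k f)) + ?S)"
    unfolding sum.distrib[symmetric]
    by (intro dvd_sum) (auto simp: minus_one_power_iff)
  ultimately show ?case
    using S even_diff_iff by (simp del: sum.atMost_Suc add: algebra_simps even_diff_iff)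
next
  case (diff a b)
  from dvd_diff[OF this] show ?case
    by (simp add: chain_boundary_diff algebra_simps)
qed auto

text \<open>The map \<open>g\<close> turns every label into its opposite. For compatible labels this
  commutes with sorting, so alternation is kept and the starting sign flips.\<close>

lemma fan_weight_antipode:
  assumes lam: "\<And>z. z \<in> topspace X \<Longrightarrow> lam (g z) = opp (lam z)"
    and c: "singular_chain p X c"
    and comp: "\<And>f. f \<in> Poly_Mapping.keys c \<Longrightarrow> compatible (set (vertex_labels lam p f))"
  shows "chain_eval (fan_weight lam s p) (chain_map p g c) = chain_eval (fan_weight lam (\<not> s) p) c"
proof -
  have "Poly_Mapping.keys c \<subseteq> {f. singular_simplex p X f \<and> compatible (set (vertex_labels lam p f))}"
    using c comp by (auto simp: singular_chain_def)
  then show ?thesis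
  proof (induction c rule: frag_induction)
    case (one f)
    have "lam (simplicial_vertex i (simplex_map p g f)) = opp (lam (simplicial_vertex i f))"
      if "i \<le> p" for i
    proof -
      have e: "(\<lambda>j. if j = i then 1 else 0) \<in> standard_simplex p"
        using that by simp
      then have "f (\<lambda>j. if j = i then 1 else 0) \<in> topspace X"
        using one by (auto simp: singular_simplex_def continuous_map_def)
      then show ?thesis
        using e by (simp add: simplicial_vertex_def simplex_map_def lam)
    qed
    then have "vertex_labels lam p (simplex_map p g f) = map opp (vertex_labels lam p f)"
      by (auto simp: vertex_labels_def)
    then show ?case
      using one by (simp add: fan_weight_def sort_map_opp alternating_map_opp)
  qed (auto simp: chain_map_diff)
qed

subsection \<open>The Borsuk--Ulam theorem\<close>

definition octa :: "nat \<Rightarrow> (nat \<Rightarrow> real) set" where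
  "octa n = {z. (\<forall>i>n. z i = 0) \<and> (\<Sum>i\<le>n. \<bar>z i\<bar>) = 1}"

definition axis_vec :: "nat \<Rightarrow> nat \<Rightarrow> real" where
  "axis_vec i = (\<lambda>j. if j = i then 1 else 0)"

abbreviation antipode :: "(nat \<Rightarrow> real) \<Rightarrow> nat \<Rightarrow> real" where
  "antipode z \<equiv> (\<lambda>i. - z i)"

text \<open>
  The cone with apex \<open>axis_vec (k + 1)\<close> over the cycle \<open>c k \<plusminus> T (c k)\<close>, which is the
  \<open>k\<close>-dimensional octahedral sphere.
\<close>

primrec hemisphere :: "nat \<Rightarrow> (nat \<Rightarrow> real) chain" where
  "hemisphere 0 = frag_of (\<lambda>u\<in>standard_simplex 0. axis_vec 0)"
| "hemisphere (Suc k) = simplicial_cone k (axis_vec (Suc k))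
     (hemisphere k - frag_cmul ((-1) ^ k) (chain_map k antipode (hemisphere k)))"

lemma octa_mono: "k \<le> n \<Longrightarrow> octa k \<subseteq> octa n"
proof (clarsimp simp: octa_def)
  fix z :: "nat \<Rightarrow> real"
  assume "k \<le> n" "\<forall>i>k. z i = 0" "(\<Sum>i\<le>k. \<bar>z i\<bar>) = 1"
  then show "(\<Sum>i\<le>n. \<bar>z i\<bar>) = 1"
    using sum.mono_neutral_left[of "{..n}" "{..k}" "\<lambda>i. \<bar>z i\<bar>"] by auto
qed

lemma antipode_in_octa_iff [simp]: "antipode z \<in> octa n \<longleftrightarrow> z \<in> octa n"
  by (simp add: octa_def)

text \<open>The apex and \<open>x\<close> have disjoint supports, so their norms add up to
  \<open>(1 - u) + u = 1\<close>. This is the advantage of the \<open>l^1\<close> sphere: straight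
  cones stay on it, and affine simplices suffice.\<close>

lemma cone_octa:
  assumes "0 \<le> u" "u \<le> 1" "x \<in> octa k"
  shows "(\<lambda>i. (1 - u) * axis_vec (Suc k) i + u * x i) \<in> octa (Suc k)"
proof -
  have "(\<Sum>i\<le>k. \<bar>(1 - u) * axis_vec (Suc k) i + u * x i\<bar>) = (\<Sum>i\<le>k. u * \<bar>x i\<bar>)"
    using assms by (intro sum.cong) (auto simp: axis_vec_def abs_mult)
  also have "\<dots> = u"
    using assms by (simp add: octa_def flip: sum_distrib_left)
  finally show ?thesis
    using assms by (auto simp: octa_def axis_vec_def)
qed

text \<open>The antipodal map is linear, so it carries an affine simplex to the affine simplex on
  the negated vertices.\<close>

lemma simplicial_chain_antipode:
  assumes "simplicial_chain p (octa n) c"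
  shows "simplicial_chain p (octa n) (chain_map p antipode c)"
  using assms unfolding simplicial_chain_def
proof (induction c rule: frag_induction)
  case (one f)
  then obtain l where f: "f ` standard_simplex p \<subseteq> octa n" "f = oriented_simplex p l"
    by (auto simp: simplicial_simplex)
  have "simplex_map p antipode f = oriented_simplex p (\<lambda>j i. - l j i)"
    by (auto simp: simplex_map_def f(2) oriented_simplex_def fun_eq_iff sum_negf)
  moreover have "simplex_map p antipode f ` standard_simplex p \<subseteq> octa n"
    using f(1) by (auto simp: simplex_map_def)
  ultimately show ?case
    by (auto simp: simplicial_simplex)
next
  case (diff a b)
  then show ?case
    using simplicial_chain_diff unfolding simplicial_chain_def chain_map_diff by metis
qed auto

lemma simplicial_chain_hemisphere: "simplicial_chain k (octa k) (hemisphere k)"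
proof (induction k)
  case 0
  have "(\<lambda>u\<in>standard_simplex 0. axis_vec 0) = oriented_simplex 0 (\<lambda>_. axis_vec 0)"
    by (auto simp: oriented_simplex_def standard_simplex_0 fun_eq_iff restrict_def)
  moreover have "(\<lambda>u\<in>standard_simplex 0. axis_vec 0) ` standard_simplex 0 \<subseteq> octa 0"
    by (auto simp: octa_def axis_vec_def)
  ultimately show ?case
    by (metis hemisphere.simps(1) simplicial_chain_of simplicial_simplex)
next
  case (Suc k)
  have "simplicial_chain k (octa k)
     (hemisphere k - frag_cmul ((-1) ^ k) (chain_map k antipode (hemisphere k)))"
    by (intro simplicial_chain_diff simplicial_chain_cmul simplicial_chain_antipode Suc)
  then show ?case
    by (auto intro: simplicial_chain_simplicial_cone cone_octa)
qed

lemma chain_map_antipode_antipode: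
  assumes "singular_chain p (subtopology (powertop_real UNIV) S) c"
  shows "chain_map p antipode (chain_map p antipode c) = c"
proof -
  have "chain_map p antipode (chain_map p antipode c) = chain_map p (antipode \<circ> antipode) c"
    by (simp add: chain_map_compose)
  also have "\<dots> = c"
    using assms by (intro chain_map_id_gen) auto
  finally show ?thesis .
qed

text \<open>The boundary of a cone is its base minus the cone over the boundary of the base. The
  base is a cycle: by induction and because the antipodal map is an involution, the boundaries of
  its two halves cancel.\<close>

lemma chain_boundary_hemisphere:
  "chain_boundary (Suc k) (hemisphere (Suc k)) =
     hemisphere k - frag_cmul ((-1) ^ k) (chain_map k antipode (hemisphere k))"
proof (induction k)
  case 0
  \<comment> \<open>In dimension 0 the correction term is the apex times the sum of the coefficients
    of the base; here these are 1 and -1.\<close>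
  have "simplicial_chain 0 (octa 0)
     (hemisphere 0 - frag_cmul ((-1) ^ 0) (chain_map 0 antipode (hemisphere 0)))"
    by (intro simplicial_chain_diff simplicial_chain_cmul simplicial_chain_antipode 
        simplicial_chain_hemisphere)
  from chain_boundary_simplicial_cone[OF this] show ?case
    by (simp add: frag_extend_diff)
next
  case (Suc k)
  let ?c = "hemisphere (Suc k)"
  let ?z = "?c - frag_cmul ((-1) ^ Suc k) (chain_map (Suc k) antipode ?c)"
  let ?X = "\<lambda>k. subtopology (powertop_real UNIV) (octa k)"
  have sc: "singular_chain k (?X k) (hemisphere k)" for k
    by (intro simplicial_imp_singular_chain simplicial_chain_hemisphere)
  have "simplicial_chain (Suc k) (octa (Suc k)) ?z"
    by (intro simplicial_chain_diff simplicial_chain_cmul simplicial_chain_antipode 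
        simplicial_chain_hemisphere)
  from chain_boundary_simplicial_cone[OF this]
  have "chain_boundary (Suc (Suc k)) (hemisphere (Suc (Suc k))) =
     ?z - simplicial_cone k (axis_vec (Suc (Suc k))) (chain_boundary (Suc k) ?z)"
    by simp
  moreover have "chain_boundary (Suc k) ?z = 0"
    using chain_boundary_chain_map[OF sc, of "Suc k" antipode]
    by (cases "even k") (simp_all add: chain_boundary_diff chain_boundary_add chain_boundary_cmul Suc
        chain_map_diff chain_map_add chain_map_antipode_antipode[OF sc] del: hemisphere.simps)
  ultimately show ?case by (simp add: simplicial_cone_def)
qed

section \<open>Iterated subdivision of chains\<close>

lemma singular_chain_iterated_subdivision:
  "singular_chain p X c \<Longrightarrow> singular_chain p X ((singular_subdivision p ^^ m) c)"
  by (induction m) (auto intro: singular_chain_singular_subdivision)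

lemma chain_boundary_iterated_subdivision:
  "singular_chain p X c \<Longrightarrow> chain_boundary p ((singular_subdivision p ^^ m) c) =
     (singular_subdivision (p - 1) ^^ m) (chain_boundary p c)"
  by (induction m) (auto simp: chain_boundary_singular_subdivision[OF singular_chain_iterated_subdivision])

lemma chain_map_iterated_subdivision:
  "singular_chain p X c \<Longrightarrow> (singular_subdivision p ^^ m) (chain_map p g c) =
     chain_map p g ((singular_subdivision p ^^ m) c)"
  by (induction m) (auto simp: naturality_singular_subdivision[OF singular_chain_iterated_subdivision])

lemma iterated_subdivision_cmul:
  "(singular_subdivision p ^^ m) (frag_cmul a c) = frag_cmul a ((singular_subdivision p ^^ m) c)"
  by (induction m) (auto simp: singular_subdivision_def frag_extend_cmul)

lemma iterated_subdivision_0: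
  "singular_simplex 0 X f \<Longrightarrow> (singular_subdivision 0 ^^ m) (frag_of f) = frag_of f"
  by (induction m) (auto simp: singular_subdivision_def singular_simplex_chain_map_id simp del: chain_map_of)

text \<open>Tucker's lemma with an open cover in place of a triangulation, so the labelling need not
  be continuous. Subdivision makes every simplex of the hemispheres lie in a member of the cover; if
  all members were compatible, Fan's parity count would give an alternating simplex with too many
  labels.\<close>

proposition Tucker_cover:
  fixes lam :: "(nat \<Rightarrow> real) \<Rightarrow> nat"
  assumes lam: "\<And>z. z \<in> octa n \<Longrightarrow> lam z < 2 * n"
    and odd: "\<And>z. z \<in> octa n \<Longrightarrow> lam (antipode z) = opp (lam z)"
    and op: "\<And>U. U \<in> \<U> \<Longrightarrow> openin (subtopology (powertop_real UNIV) (octa n)) U"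
    and cov: "octa n \<subseteq> \<Union>\<U>"
  obtains U where "U \<in> \<U>" "\<not> compatible (lam ` U)"
proof -
  let ?X = "subtopology (powertop_real UNIV) (octa n)"
  have "\<exists>U\<in>\<U>. \<not> compatible (lam ` U)"
  proof (rule ccontr)
    assume "\<not> ?thesis"
    then have comp: "compatible (lam ` U)" if "U \<in> \<U>" for U
      using that by blast
    have sc: "singular_chain k ?X (hemisphere k)" if "k \<le> n" for k
      using singular_chain_mono[OF simplicial_imp_singular_chain[OF simplicial_chain_hemisphere] octa_mono[OF that]] .
    have "\<exists>N. \<forall>m f. N \<le> m \<longrightarrow> f \<in> Poly_Mapping.keys ((singular_subdivision k ^^ m) (hemisphere k))
        \<longrightarrow> (\<exists>V\<in>\<U>. f \<in> standard_simplex k \<rightarrow> V)" if "k \<le> n" for k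
    proof -
      have "topspace ?X \<subseteq> \<Union>\<U>"
        using cov by simp
      from sufficient_iterated_singular_subdivision_exists[OF op this sc[OF that]]
      show ?thesis by blast
    qed
    then obtain N where N: "\<And>k m f. \<lbrakk>k \<le> n; N k \<le> m; 
        f \<in> Poly_Mapping.keys ((singular_subdivision k ^^ m) (hemisphere k))\<rbrakk>
        \<Longrightarrow> \<exists>V\<in>\<U>. f \<in> standard_simplex k \<rightarrow> V"
      by metis
    \<comment> \<open>The boundary relation compares chains subdivided equally often, so one depth
      must serve all dimensions up to \<open>n\<close>.\<close>
    define m where "m = Max (N ` {..n})"
    define c where "c k = (singular_subdivision k ^^ m) (hemisphere k)" for k
    define t where "t k = chain_eval (fan_weight lam True k) (c k) + chain_eval (fan_weight lam False k) (c k)" for k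
    have c: "singular_chain k ?X (c k)" if "k \<le> n" for k
      unfolding c_def by (rule singular_chain_iterated_subdivision[OF sc[OF that]])
    have cc: "compatible (set (vertex_labels lam k f)) \<and> set (vertex_labels lam k f) \<subseteq> {..<2 * n}"
      if kn: "k \<le> n" and f: "f \<in> Poly_Mapping.keys (c k)" for k f
    proof -
      have "N k \<le> m"
        unfolding m_def using kn by auto
      then obtain V where V: "V \<in> \<U>" "f \<in> standard_simplex k \<rightarrow> V"
        using N[OF kn] f unfolding c_def by blast
      have "set (vertex_labels lam k f) \<subseteq> lam ` V"
        using V(2) by (auto simp: vertex_labels_def simplicial_vertex_def Pi_iff simp del: upt_Suc)
      moreover have "lam ` V \<subseteq> {..<2 * n}"
        using lam openin_subset[OF op[OF V(1)]] by auto
      ultimately show ?thesis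
        using comp[OF V(1)] unfolding compatible_def by blast
    qed
    \<comment> \<open>Modulo 2 the weight of the boundary of \<open>c (Suc k)\<close> is computed
      twice: face counting gives \<open>t (Suc k)\<close>, and the hemisphere formula gives
      \<open>t k\<close>, because the antipodal copy exchanges the two starting signs.\<close>
    have "even (t (Suc k) + t k)" if "Suc k \<le> n" for k
    proof -
      have k: "k \<le> n" using that by simp
      have "chain_boundary (Suc k) (c (Suc k)) = c k - frag_cmul ((-1) ^ k) (chain_map k antipode (c k))"
        unfolding c_def
        by (simp add: chain_boundary_iterated_subdivision[OF sc[OF that]] chain_boundary_hemisphere
            singular_subdivision_power_diff iterated_subdivision_cmul
            chain_map_iterated_subdivision[OF sc[OF k]] del: hemisphere.simps)
      then have "chain_eval (fan_weight lam True k) (chain_boundary (Suc k) (c (Suc k)))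
        = chain_eval (fan_weight lam True k) (c k) - (-1) ^ k * chain_eval (fan_weight lam False k) (c k)"
        using fan_weight_antipode[of ?X lam antipode k "c k" True] odd c[OF k] cc[OF k] by simp
      then show ?thesis
        using fan_weight_boundary_parity[of lam True k "c (Suc k)"] unfolding t_def
        by (cases "even k") auto
    qed
    then have "odd (t k)" if "k \<le> n" for k
      using that
    proof (induction k)
      case 0
      \<comment> \<open>The chain \<open>c 0\<close> is a single point; its one label alternates for
        exactly one starting sign, so \<open>t 0 = 1\<close>.\<close>
      have "singular_simplex 0 ?X (\<lambda>u\<in>standard_simplex 0. axis_vec 0)"
        using sc[of 0] by (simp add: singular_chain_of)
      then have "c 0 = hemisphere 0"
        by (simp add: c_def iterated_subdivision_0)
      then show ?case
        by (simp add: t_def fan_weight_def vertex_labels_def)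
    next
      case (Suc k)
      then show ?case
        by (meson Suc_leD even_add)
    qed
    then have "t n \<noteq> 0"
      by (metis even_zero order_refl)
    then obtain s where "chain_eval (fan_weight lam s n) (c n) \<noteq> 0"
      unfolding t_def by (metis add.right_neutral)
    then obtain f where f: "f \<in> Poly_Mapping.keys (c n)" "fan_weight lam s n f \<noteq> 0"
      by (rule chain_eval_nonzero)
    \<comment> \<open>An alternating \<open>n\<close>-simplex carries \<open>n + 1\<close> labels,
      while only \<open>n\<close> absolute values are available.\<close>
    then have "length (sort (vertex_labels lam n f)) \<le> n"
      using cc[OF order_refl f(1)]
      by (intro length_alternating_le[where s = s]) (auto simp: fan_weight_def)
    then show False by simp
  qed
  then show ?thesis using that by blast
qed

text \<open>Without a common zero, each point can be labelled by a coordinate of \<open>F\<close> of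
  largest absolute value together with its sign. This labelling is antipodal, and by continuity
  complementary labels do not occur near a common point, against Tucker's lemma.\<close>

theorem Borsuk_Ulam_octa:
  fixes F :: "nat \<Rightarrow> (nat \<Rightarrow> real) \<Rightarrow> real"
  assumes cont: "\<And>i. i < n \<Longrightarrow> continuous_on (octa n) (F i)"
    and odd: "\<And>i z. i < n \<Longrightarrow> z \<in> octa n \<Longrightarrow> F i (antipode z) = - F i z"
  obtains z where "z \<in> octa n" "\<And>i. i < n \<Longrightarrow> F i z = 0"
proof -
  have "\<exists>z\<in>octa n. \<forall>i<n. F i z = 0"
  proof (rule ccontr)
    assume "\<not> ?thesis"
    then have nz: "\<exists>i<n. F i z \<noteq> 0" if "z \<in> octa n" for z
      using that by blast
    define M where "M z = Max ((\<lambda>i. \<bar>F i z\<bar>) ` {..<n})" for z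
    have M_ge: "\<bar>F i z\<bar> \<le> M z" if "i < n" for i z
      unfolding M_def using that by auto
    have M_pos: "0 < M z" if "z \<in> octa n" for z
      using nz[OF that] M_ge by (metis abs_le_zero_iff linorder_not_less order.trans)
    \<comment> \<open>The least maximizing index depends only on the absolute values of the
      coordinates, so it is the same at antipodal points.\<close>
    define idx where "idx z = (LEAST i. i < n \<and> \<bar>F i z\<bar> = M z)" for z
    have idx: "idx z < n \<and> \<bar>F (idx z) z\<bar> = M z" if "z \<in> octa n" for z
    proof -
      have "M z \<in> (\<lambda>i. \<bar>F i z\<bar>) ` {..<n}"
        unfolding M_def using nz[OF that] by (intro Max_in) auto
      then have "\<exists>i. i < n \<and> \<bar>F i z\<bar> = M z" by auto
      then show ?thesis
        unfolding idx_def by (rule LeastI_ex)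
    qed
    define lam where "lam z = (if F (idx z) z > 0 then 2 * idx z else Suc (2 * idx z))" for z
    define V where "V z = {w \<in> octa n. \<forall>i<n. \<bar>F i w - F i z\<bar> < M z / 2}" for z
    have abs_anti: "\<bar>F i (antipode z)\<bar> = \<bar>F i z\<bar>" if "i < n" "z \<in> octa n" for i z
      using odd[OF that] by simp
    have M_anti: "M (antipode z) = M z" if "z \<in> octa n" for z
      unfolding M_def using abs_anti that by (intro arg_cong[of _ _ Max] image_cong) auto
    have idx_anti: "idx (antipode z) = idx z" if "z \<in> octa n" for z
      using abs_anti that by (simp add: idx_def M_anti cong: conj_cong)
    have op: "openin (subtopology (powertop_real UNIV) (octa n)) (V z)" for z
    proof -
      have "V z = octa n \<inter> (\<Inter>i\<in>{..<n}. octa n \<inter> (F i) -` {F i z - M z / 2 <..< F i z + M z / 2})"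
      proof -
        have "\<bar>F i w - F i z\<bar> < M z / 2 \<longleftrightarrow> F i w \<in> {F i z - M z / 2 <..< F i z + M z / 2}" for i w
          by (auto simp: abs_if)
        then show ?thesis
          unfolding V_def by blast
      qed
      moreover have "openin (top_of_set (octa n)) \<dots>"
      proof (cases "n = 0")
        case False
        then show ?thesis
          using cont by (intro openin_Int openin_INT2 continuous_openin_preimage_gen) auto
      qed auto
      ultimately show ?thesis
        by (simp add: euclidean_product_topology)
    qed
    have cov: "octa n \<subseteq> \<Union>(V ` octa n)"
      using M_pos by (auto simp: V_def)
    have lam_less: "lam z < 2 * n" if "z \<in> octa n" for z
      using idx[OF that] by (auto simp: lam_def)
    have lam_anti: "lam (antipode z) = opp (lam z)" if "z \<in> octa n" for z
      using idx[OF that] M_pos[OF that] odd[OF _ that, of "idx z"] idx_anti[OF that]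
      by (auto simp: lam_def opp_def)
    obtain U where "U \<in> V ` octa n" "\<not> compatible (lam ` U)"
      by (rule Tucker_cover[of n lam "V ` octa n", OF lam_less lam_anti _ cov]) (use op in auto)
    then obtain z where z: "z \<in> octa n" "\<not> compatible (lam ` V z)"
      by blast
    \<comment> \<open>All coordinates move by less than \<open>M z / 2\<close> on
      \<open>V z\<close>. The maximum at \<open>w\<close> thus still exceeds \<open>M z / 2\<close>,
      so the coordinate attaining it has the same sign at \<open>w\<close> and at \<open>z\<close>:
      the centre \<open>z\<close> fixes the sign that goes with each index.\<close>
    have sgn: "F i z > 0 \<longleftrightarrow> even (lam w)" "i < n" if "w \<in> V z" "i = lam w div 2" for i w
    proof -
      have w: "w \<in> octa n" using that by (simp add: V_def)
      have i: "i = idx w" using that by (auto simp: lam_def)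
      then show "i < n" using idx[OF w] by simp
      obtain j where j: "j < n" "\<bar>F j z\<bar> = M z" using idx[OF z(1)] by blast
      have "\<bar>F j w - F j z\<bar> < M z / 2"
        using that(1) j(1) by (simp add: V_def)
      then have "M z / 2 < \<bar>F j w\<bar>"
        using j(2) by arith
      also have "\<dots> \<le> M w" by (rule M_ge[OF j(1)])
      also have "\<dots> = \<bar>F i w\<bar>" using i idx[OF w] by simp
      finally have "M z / 2 < \<bar>F i w\<bar>" .
      moreover have "\<bar>F i w - F i z\<bar> < M z / 2"
        using that(1) \<open>i < n\<close> by (simp add: V_def)
      moreover have "even (lam w) \<longleftrightarrow> F i w > 0"
        using i by (simp add: lam_def)
      ultimately show "F i z > 0 \<longleftrightarrow> even (lam w)"
        using M_pos[OF z(1)] by (auto simp: abs_if split: if_splits)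
    qed
    from z(2) obtain v w where vw: "v \<in> V z" "w \<in> V z" "lam w = opp (lam v)"
      by (auto simp: compatible_def)
    have "lam w div 2 = lam v div 2"
      using vw(3) by (simp add: opp_div_2)
    then have "even (lam w) = even (lam v)"
      using sgn(1)[OF vw(1) refl] sgn(1)[OF vw(2) refl] by simp
    then show False using vw(3) by simp
  qed
  then show ?thesis using that by blast
qed

subsection \<open>Measures that vanish on axis-parallel lines\<close>

text \<open>Abstracts what a density provides: axis-parallel lines are null. The measure lives on
  the whole plane, with its mass on the square, so that boxes are measurable wherever they
  lie.\<close>

locale line_null_prob = prob_space N for N :: "(real \<times> real) measure" +
  assumes sets_eq [measurable_cong, simp]: "sets N = sets borel"
    and vertical_null: "AE p in N. fst p \<noteq> a"
    and horizontal_null: "AE p in N. snd p \<noteq> b"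
    and unit_square: "measure N unit_square = 1"
begin

lemma space_eq [simp]: "space N = UNIV"
  using sets_eq_imp_space_eq[OF sets_eq] by simp

lemma box_in_sets [measurable]: "{a..b} \<times> {c..d} \<in> sets N"
  by (simp add: borel_closed closed_Times)

text \<open>The indicators converge at every point off the four lines through the sides of the limit
  box. These lines are null, and dominated convergence applies.\<close>

lemma tendsto_measure_box:
  fixes a b c d :: "nat \<Rightarrow> real"
  assumes a: "a \<longlonglongrightarrow> a0" and b: "b \<longlonglongrightarrow> b0" and c: "c \<longlonglongrightarrow> c0" and d: "d \<longlonglongrightarrow> d0"
  shows "(\<lambda>m. measure N ({a m..b m} \<times> {c m..d m})) \<longlonglongrightarrow> measure N ({a0..b0} \<times> {c0..d0})"
proof -
  have "(\<lambda>m. \<integral>p. indicat_real ({a m..b m} \<times> {c m..d m}) p \<partial>N) \<longlonglongrightarrow>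
        (\<integral>p. indicat_real ({a0..b0} \<times> {c0..d0}) p \<partial>N)"
  proof (rule integral_dominated_convergence[where w = "\<lambda>_. 1"])
    show "AE p in N. (\<lambda>m. indicat_real ({a m..b m} \<times> {c m..d m}) p)
        \<longlonglongrightarrow> indicat_real ({a0..b0} \<times> {c0..d0}) p"
      using vertical_null[of a0] vertical_null[of b0] horizontal_null[of c0] horizontal_null[of d0]
    proof eventually_elim
      case (elim p)
      have *: "\<forall>\<^sub>F m in sequentially. (u m \<le> t) = (u0 \<le> t)" "\<forall>\<^sub>F m in sequentially. (t \<le> u m) = (t \<le> u0)"
        if u: "u \<longlonglongrightarrow> u0" and t: "t \<noteq> u0" for u :: "nat \<Rightarrow> real" and u0 t
      proof -
        consider "u0 < t" | "t < u0"
          using t by linarith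
        then have "\<forall>\<^sub>F m in sequentially. (u m \<le> t) = (u0 \<le> t) \<and> (t \<le> u m) = (t \<le> u0)"
        proof cases
          case 1
          then show ?thesis
            using order_tendstoD(2)[OF u 1] by (auto elim!: eventually_mono)
        next
          case 2
          then show ?thesis
            using order_tendstoD(1)[OF u 2] by (auto elim!: eventually_mono)
        qed
        then show "\<forall>\<^sub>F m in sequentially. (u m \<le> t) = (u0 \<le> t)" "\<forall>\<^sub>F m in sequentially. (t \<le> u m) = (t \<le> u0)"
          by (auto elim: eventually_mono)
      qed
      have "\<forall>\<^sub>F m in sequentially. indicat_real ({a m..b m} \<times> {c m..d m}) p =
          indicat_real ({a0..b0} \<times> {c0..d0}) p"
        using *(1)[OF a elim(1)] *(2)[OF b elim(2)] *(1)[OF c elim(3)] *(2)[OF d elim(4)]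
        by eventually_elim (auto simp: indicator_def mem_Times_iff)
      then show ?case
        by (rule tendsto_eventually)
    qed
  qed (auto simp: indicator_def)
  then show ?thesis by simp
qed

lemma AE_disjoint_boxes:
  assumes "b \<le> a' \<or> d \<le> c'"
  shows "AE p in N. p \<notin> {a..b} \<times> {c..d} \<or> p \<notin> {a'..b'} \<times> {c'..d'}"
  using vertical_null[of b] horizontal_null[of d] 
  by eventually_elim (use assms in auto)

lemma measure_horizontal_segment: "measure N ({a..b} \<times> {c..c}) = 0"
proof -
  have "AE p in N. p \<notin> {a..b} \<times> {c..c}"
    using horizontal_null[of c] by eventually_elim auto
  then show ?thesis
    using prob_eq_0[OF box_in_sets[of a b c c]] by simp
qed

lemma measure_vertical_segment: "measure N ({a..a} \<times> {c..d}) = 0"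
proof -
  have "AE p in N. p \<notin> {a..a} \<times> {c..d}"
    using vertical_null[of a] by eventually_elim auto
  then show ?thesis
    using prob_eq_0[OF box_in_sets[of a a c d]] by simp
qed

end

text \<open>Here \<open>id\<close> acts as the inclusion of the square into the plane. A density
  turns Lebesgue null sets into null sets, which covers the axis-parallel lines.\<close>

lemma continuous_prob_measure_distr:
  assumes "continuous_prob_measure M"
  shows "line_null_prob (distr M borel id)"
    and "\<And>A. A \<in> sets borel \<Longrightarrow> A \<subseteq> unit_square \<Longrightarrow> measure (distr M borel id) A = measure M A"
proof -
  obtain f where P: "prob_space M" and f: "f \<in> borel_measurable (restrict_space lborel unit_square)"
    and M: "M = density (restrict_space lborel unit_square) f"
    using assms by (auto simp: continuous_prob_measure_def)
  have usq: "unit_square \<in> sets borel"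
    by (simp add: unit_square_def borel_closed closed_Times)
  have space: "space M = unit_square"
    by (simp add: M space_restrict_space)
  have id [measurable]: "id \<in> M \<rightarrow>\<^sub>M borel"
    unfolding M by (simp add: measurable_restrict_space1)
  show eq: "measure (distr M borel id) A = measure M A" if "A \<in> sets borel" "A \<subseteq> unit_square" for A
    using that by (simp add: measure_distr space Int_absorb2)
  interpret prob_space M by fact
  have null: "AE p in distr M borel id. p \<notin> L" if "closed L" "L \<in> null_sets lborel" for L
  proof -
    have "AE p in lborel. p \<notin> L"
      using that(2) by (rule AE_not_in)
    then have "AE p in restrict_space lborel unit_square. p \<notin> L"
      using usq by (subst AE_restrict_space_iff) auto
    then have "AE p in M. p \<notin> L"
      unfolding M by (subst AE_density[OF f]) auto
    moreover have "{p. p \<notin> L} \<in> sets borel"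
      using borel_open[of "- L"] that(1) by (simp add: Compl_eq[symmetric] open_Compl)
    ultimately show ?thesis
      by (subst AE_distr_iff) auto
  qed
  \<comment> \<open>The product formula gives zero times infinity, which is zero for extended
    nonnegative reals.\<close>
  have vert: "{a} \<times> UNIV \<in> null_sets (lborel :: (real \<times> real) measure)" for a :: real
    unfolding lborel_prod[symmetric] using lborel.emeasure_pair_measure_Times[of "{a}" lborel UNIV] 
    by (auto simp: null_sets_def)
  have horiz: "UNIV \<times> {b} \<in> null_sets (lborel :: (real \<times> real) measure)" for b :: real
    unfolding lborel_prod[symmetric] using lborel.emeasure_pair_measure_Times[of UNIV lborel "{b}"] 
    by (auto simp: null_sets_def)
  show "line_null_prob (distr M borel id)"
  proof (intro line_null_prob.intro line_null_prob_axioms.intro)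
    show "prob_space (distr M borel id)"
      by (rule prob_space_distr) simp
    show "AE p in distr M borel id. fst p \<noteq> a" for a
      using null[OF _ vert[of a]] by (auto simp: closed_Times mem_Times_iff)
    show "AE p in distr M borel id. snd p \<noteq> b" for b
      using null[OF _ horiz[of b]] by (auto simp: closed_Times mem_Times_iff)
    show "measure (distr M borel id) unit_square = 1"
      using eq[OF usq] prob_space by (simp add: space)
  qed simp
qed

text \<open>The sign jumps only where \<open>w\<close> vanishes; there \<open>D\<close> tends to 0
  and the bounded factor does no harm. It will be applied to a coordinate of \<open>z\<close> and
  the measure of its piece.\<close>

lemma continuous_on_sgn_mult:
  fixes w D :: "'a::topological_space \<Rightarrow> real"
  assumes "continuous_on S w" "continuous_on S D" and zero: "\<And>z. z \<in> S \<Longrightarrow> w z = 0 \<Longrightarrow> D z = 0"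
  shows "continuous_on S (\<lambda>z. sgn (w z) * D z)"
  unfolding continuous_on_def
proof
  fix z assume z: "z \<in> S"
  have w: "(w \<longlongrightarrow> w z) (at z within S)" and D: "(D \<longlongrightarrow> D z) (at z within S)"
    using assms z by (auto simp: continuous_on_def)
  show "((\<lambda>z. sgn (w z) * D z) \<longlongrightarrow> sgn (w z) * D z) (at z within S)"
  proof (cases "w z = 0")
    case True
    then have "(D \<longlongrightarrow> 0) (at z within S)"
      using D zero[OF z] by simp
    then have "((\<lambda>z. sgn (w z) * D z) \<longlongrightarrow> 0) (at z within S)"
      by (rule tendsto_0_le[where K = 1]) (auto simp: abs_mult abs_sgn_eq)
    then show ?thesis using True by simp
  next
    case False
    then show ?thesis by (intro tendsto_mult tendsto_sgn w D)
  qed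
qed

lemma UN_consecutive_intervals:
  fixes u :: "nat \<Rightarrow> real"
  assumes "\<And>i. u i \<le> u (Suc i)"
  shows "(\<Union>i\<le>m. {u i..u (Suc i)}) = {u 0..u (Suc m)}"
proof (induction m)
  case (Suc m)
  have "u 0 \<le> u (Suc m)"
    using lift_Suc_mono_le[of u 0 "Suc m"] assms by simp
  then show ?case
    using Suc assms[of "Suc m"] by (auto simp: atMost_Suc ivl_disj_un)
qed auto

subsection \<open>The division of the square given by a point of the sphere\<close>

definition psum :: "(nat \<Rightarrow> real) \<Rightarrow> nat \<Rightarrow> real" where
  "psum z k = (\<Sum>i<k. \<bar>z i\<bar>)"

text \<open>
  If the bottom strip has height 0, the vertical cuts are immaterial; they are all put at 1.
\<close>

definition xcut :: "nat \<Rightarrow> (nat \<Rightarrow> real) \<Rightarrow> nat \<Rightarrow> real" where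
  "xcut m z j = (if psum z (Suc m) = 0 then of_bool (j \<noteq> 0) else psum z j / psum z (Suc m))"

text \<open>The index 0 is set apart because the formula would give \<open>psum z m\<close> there.
  At \<open>j = 1\<close> it gives the height of the bottom strip.\<close>

definition ycut :: "nat \<Rightarrow> (nat \<Rightarrow> real) \<Rightarrow> nat \<Rightarrow> real" where
  "ycut m z j = (if j = 0 then 0 else psum z (m + j))"

definition piece :: "nat \<Rightarrow> (nat \<Rightarrow> real) \<Rightarrow> nat \<Rightarrow> (real \<times> real) set" where
  "piece m z k = (if k \<le> m then {xcut m z k..xcut m z (Suc k)} \<times> {0..psum z (Suc m)}
     else {0..1} \<times> {psum z k..psum z (Suc k)})"

lemma psum_0 [simp]: "psum z 0 = 0"
  by (simp add: psum_def)

lemma psum_Suc: "psum z (Suc k) = psum z k + \<bar>z k\<bar>"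
  by (simp add: psum_def)

lemma psum_mono: "k \<le> l \<Longrightarrow> psum z k \<le> psum z l"
  unfolding psum_def by (intro sum_mono2) auto

lemma psum_nonneg [simp]: "0 \<le> psum z k"
  by (simp add: psum_def sum_nonneg)

lemma psum_antipode [simp]: "psum (antipode z) k = psum z k"
  by (simp add: psum_def)

lemma psum_octa: "z \<in> octa n \<Longrightarrow> psum z (Suc n) = 1"
  by (simp add: psum_def octa_def lessThan_Suc_atMost)

lemma xcut_mono: "k \<le> l \<Longrightarrow> xcut m z k \<le> xcut m z l"
  by (auto simp: xcut_def intro: divide_right_mono psum_mono)

lemma xcut_0 [simp]: "xcut m z 0 = 0"
  by (simp add: xcut_def)

lemma xcut_Suc [simp]: "xcut m z (Suc m) = 1"
  by (simp add: xcut_def)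

lemma piece_antipode [simp]: "piece m (antipode z) k = piece m z k"
  by (simp add: piece_def xcut_def)

lemma cut_points_xcut: "cut_points m (xcut m z)"
  by (simp add: cut_points_def xcut_mono)

lemma cut_points_ycut:
  assumes "z \<in> octa (m + m')"
  shows "cut_points m' (ycut m z)"
  using psum_octa[OF assms] by (auto simp: cut_points_def ycut_def intro: psum_mono)

lemma UN_xcut: "(\<Union>i\<le>m. {xcut m z i..xcut m z (Suc i)}) = {0..1}"
  using UN_consecutive_intervals[of "xcut m z" m] by (simp add: xcut_mono)

lemma UN_piece:
  assumes "z \<in> octa n" "m \<le> n"
  shows "(\<Union>k\<le>n. piece m z k) = unit_square"
proof -
  have "(\<Union>k\<le>m. piece m z k) = {0..1} \<times> {0..psum z (Suc m)}"
    using UN_xcut[of m z] by (auto simp: piece_def)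
  moreover have "(\<Union>k\<in>{m<..n}. piece m z k) \<union> {0..1} \<times> {0..psum z (Suc m)} = {0..1} \<times> {0..psum z (Suc n)}"
    using \<open>m \<le> n\<close>
  proof (induction n rule: dec_induct)
    case (step l)
    have "{m<..Suc l} = insert (Suc l) {m<..l}"
      using step by auto
    then have "(\<Union>k\<in>{m<..Suc l}. piece m z k) \<union> {0..1} \<times> {0..psum z (Suc m)} =
        piece m z (Suc l) \<union> {0..1} \<times> {0..psum z (Suc l)}"
      using step.IH by auto
    also have "piece m z (Suc l) = {0..1} \<times> {psum z (Suc l)..psum z (Suc (Suc l))}"
      using step by (simp add: piece_def)
    also have "\<dots> \<union> {0..1} \<times> {0..psum z (Suc l)} = {0..1} \<times> {0..psum z (Suc (Suc l))}"
      using psum_mono[of "Suc l" "Suc (Suc l)" z] by (auto intro: order_trans[OF psum_nonneg])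
    finally show ?case .
  qed auto
  moreover have "{..n} = {..m} \<union> {m<..n}"
    using \<open>m \<le> n\<close> by auto
  ultimately show ?thesis
    using psum_octa[OF assms(1)] by (auto simp: unit_square_def)
qed

text \<open>In the bottom row each elementary rectangle is itself a piece. In a higher row
  \<open>j\<close> the colour ignores the column, so the rectangles of that row merge into the
  full-width piece \<open>m1 + j\<close>.\<close>

lemma colored_region_eq_pieces:
  assumes z: "z \<in> octa (m1 + m2)"
  shows "colored_region m1 m2 (xcut m1 z) (ycut m1 z) (\<lambda>(i, j). c (if j = 0 then i else m1 + j)) a
    = (\<Union>k\<in>{k. k \<le> m1 + m2 \<and> c k = a}. piece m1 z k)"
    (is "?L = ?R")
proof (intro subset_antisym subsetI)
  fix p assume "p \<in> ?L"
  then obtain i j where ij: "i \<le> m1" "j \<le> m2" "c (if j = 0 then i else m1 + j) = a"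
    "p \<in> elementary_rectangle (xcut m1 z) (ycut m1 z) i j"
    by (auto simp: colored_region_def)
  have "p \<in> piece m1 z (if j = 0 then i else m1 + j)"
    using ij(1,4) xcut_mono[of 0 i m1 z] xcut_mono[of "Suc i" "Suc m1" m1 z]
    by (auto simp: elementary_rectangle_def piece_def ycut_def split: if_splits)
  then show "p \<in> ?R"
    using ij by (intro UN_I[where a = "if j = 0 then i else m1 + j"]) auto
next
  fix p assume "p \<in> ?R"
  then obtain k where k: "k \<le> m1 + m2" "c k = a" "p \<in> piece m1 z k"
    by auto
  have "\<exists>i j. i \<le> m1 \<and> j \<le> m2 \<and> c (if j = 0 then i else m1 + j) = a \<and>
      p \<in> elementary_rectangle (xcut m1 z) (ycut m1 z) i j"
  proof (cases "k \<le> m1")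
    case True
    then show ?thesis
      using k by (intro exI[of _ k] exI[of _ 0]) (auto simp: elementary_rectangle_def piece_def ycut_def)
  next
    case False
    then have "fst p \<in> {0..1}" "snd p \<in> {psum z k..psum z (Suc k)}"
      using k(3) by (auto simp: piece_def)
    then obtain i where "i \<le> m1" "fst p \<in> {xcut m1 z i..xcut m1 z (Suc i)}"
      using UN_xcut[of m1 z] by blast
    then show ?thesis
      using k False \<open>snd p \<in> _\<close>
      by (intro exI[of _ i] exI[of _ "k - m1"]) (auto simp: elementary_rectangle_def ycut_def mem_Times_iff)
  qed
  then obtain i j where "i \<le> m1" "j \<le> m2" "c (if j = 0 then i else m1 + j) = a"
      "p \<in> elementary_rectangle (xcut m1 z) (ycut m1 z) i j"
    by blast
  then show "p \<in> ?L"
    unfolding colored_region_def by (intro UN_I[where a = "(i, j)"]) simp_all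
qed

section \<open>Measures of the pieces\<close>

context line_null_prob
begin

lemma piece_in_sets [measurable]: "piece m z k \<in> sets N"
  unfolding piece_def using box_in_sets by (auto simp del: sets_eq)

lemma AE_disjoint_pieces:
  assumes "k < l"
  shows "AE p in N. p \<notin> piece m z k \<or> p \<notin> piece m z l"
proof -
  have "xcut m z (Suc k) \<le> xcut m z l" "psum z (Suc k) \<le> psum z l"
    using assms by (auto intro: xcut_mono psum_mono)
  moreover have "psum z (Suc m) \<le> psum z l" if "\<not> l \<le> m"
    using that by (intro psum_mono) simp
  ultimately show ?thesis
    using assms unfolding piece_def
    by (cases "k \<le> m"; cases "l \<le> m"; simp only: if_True if_False)
      (rule AE_disjoint_boxes; simp)+
qed

lemma measure_UN_pieces:
  assumes "finite K"
  shows "measure N (\<Union>k\<in>K. piece m z k) = (\<Sum>k\<in>K. measure N (piece m z k))"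
proof (rule measure_UNION_AE[OF assms])
  show "pairwise (\<lambda>i j. AE x in N. x \<notin> piece m z i \<or> x \<notin> piece m z j) K"
    unfolding pairwise_def
  proof (intro ballI impI)
    fix i j :: nat assume "i \<noteq> j"
    then show "AE x in N. x \<notin> piece m z i \<or> x \<notin> piece m z j"
      using AE_disjoint_pieces[of i j m z] AE_disjoint_pieces[of j i m z]
      by (cases i j rule: linorder_cases) (auto simp: disj_commute)
  qed
qed (simp add: fmeasurable_eq_sets piece_in_sets del: sets_eq)

text \<open>The piece degenerates to a segment: its own width or height is 0, or the whole bottom
  strip is flat.\<close>

lemma measure_piece_eq_0: "z k = 0 \<Longrightarrow> measure N (piece m z k) = 0"
proof -
  assume z: "z k = 0"
  consider "piece m z k = {xcut m z k..xcut m z (Suc k)} \<times> {0..0}"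
    | "piece m z k = {xcut m z k..xcut m z k} \<times> {0..psum z (Suc m)}"
    | "piece m z k = {0..1} \<times> {psum z k..psum z k}"
    using z by (cases "k \<le> m"; cases "psum z (Suc m) = 0") (auto simp: piece_def xcut_def psum_Suc[of z k])
  then show ?thesis
    by cases (simp_all only: measure_horizontal_segment measure_vertical_segment)
qed

text \<open>The vertical cuts may jump where the bottom strip has height 0. Near such a point the
  pieces with \<open>k \<le> m\<close> lie in a strip whose height tends to 0, so their measures
  tend to 0 wherever the cuts are.\<close>

lemma continuous_on_measure_piece: "continuous_on S (\<lambda>z. measure N (piece m z k))"
proof -
  have "isCont (\<lambda>z. measure N (piece m z k)) z" for z
    unfolding continuous_at_sequentially comp_def
  proof (intro allI impI)
    fix u :: "nat \<Rightarrow> nat \<Rightarrow> real" assume u: "u \<longlonglongrightarrow> z"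
    have "(\<lambda>i. u i j) \<longlonglongrightarrow> z j" for j
      using continuous_on_tendsto_compose[OF continuous_on_product_coordinates u] by simp
    then have psum: "(\<lambda>i. psum (u i) j) \<longlonglongrightarrow> psum z j" for j
      unfolding psum_def by (intro tendsto_intros) auto
    show "(\<lambda>i. measure N (piece m (u i) k)) \<longlonglongrightarrow> measure N (piece m z k)"
    proof (cases "k \<le> m")
      case False
      then show ?thesis
        unfolding piece_def by (auto intro!: tendsto_measure_box psum)
    next
      case k: True
      show ?thesis
      proof (cases "psum z (Suc m) = 0")
        case False
        have "\<forall>\<^sub>F i in sequentially. psum (u i) (Suc m) \<noteq> 0"
          using tendsto_imp_eventually_ne[OF psum False] .
        then have "\<forall>\<^sub>F i in sequentially. psum (u i) j / psum (u i) (Suc m) = xcut m (u i) j" for j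
          by eventually_elim (simp add: xcut_def)
        moreover have "(\<lambda>i. psum (u i) j / psum (u i) (Suc m)) \<longlonglongrightarrow> xcut m z j" for j
          using False by (auto simp: xcut_def intro!: tendsto_divide psum)
        ultimately have "(\<lambda>i. xcut m (u i) j) \<longlonglongrightarrow> xcut m z j" for j
          by (rule Lim_transform_eventually[rotated])
        then show ?thesis
          using k unfolding piece_def by (auto intro!: tendsto_measure_box psum)
      next
        case True
        have "(\<lambda>i. measure N ({0..1} \<times> {0..psum (u i) (Suc m)})) \<longlonglongrightarrow> measure N ({0..1} \<times> {0..psum z (Suc m)})"
          by (intro tendsto_measure_box psum tendsto_const)
        then have lim0: "(\<lambda>i. measure N ({0..1} \<times> {0..psum (u i) (Suc m)})) \<longlonglongrightarrow> 0"
          using measure_horizontal_segment[of 0 1 0] by (simp add: True)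
        have "measure N (piece m (u i) k) \<le> measure N ({0..1} \<times> {0..psum (u i) (Suc m)})" for i
        proof (rule finite_measure_mono)
          show "piece m (u i) k \<subseteq> {0..1} \<times> {0..psum (u i) (Suc m)}"
            using k xcut_mono[of 0 k m "u i"] xcut_mono[of "Suc k" "Suc m" m "u i"]
            by (auto simp: piece_def)
        qed (rule box_in_sets)
        then have "(\<lambda>i. measure N (piece m (u i) k)) \<longlonglongrightarrow> 0"
          by (intro tendsto_sandwich[OF _ _ tendsto_const lim0]) auto
        moreover have "measure N (piece m z k) = 0"
          using k True measure_horizontal_segment[of _ _ 0] by (simp add: piece_def)
        ultimately show ?thesis by simp
      qed
    qed
  qed
  then show ?thesis
    by (simp add: continuous_at_imp_continuous_on)
qed

text \<open>The two coloured regions have total measure 1, as the pieces cover the square and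
  overlap in null sets. The difference of their measures is the signed sum assumed to
  vanish.\<close>

lemma measure_colored_region_eq_half:
  assumes z: "z \<in> octa (m1 + m2)"
    and zero: "(\<Sum>k\<le>m1 + m2. sgn (z k) * measure N (piece m1 z k)) = 0"
  defines "col \<equiv> \<lambda>(i, j). if 0 \<le> z (if j = 0 then i else m1 + j) then Plus else Minus"
  shows "measure N (colored_region m1 m2 (xcut m1 z) (ycut m1 z) col a) = 1 / 2"
proof -
  let ?D = "\<lambda>k. measure N (piece m1 z k)"
  let ?c = "\<lambda>k. if 0 \<le> z k then Plus else Minus"
  let ?m = "\<lambda>a. measure N (colored_region m1 m2 (xcut m1 z) (ycut m1 z) col a)"
  have col: "col = (\<lambda>(i, j). ?c (if j = 0 then i else m1 + j))"
    by (simp add: col_def)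
  have m: "?m a = (\<Sum>k\<le>m1 + m2. if ?c k = a then ?D k else 0)" for a
  proof -
    have "?m a = (\<Sum>k\<in>{k. k \<le> m1 + m2 \<and> ?c k = a}. ?D k)"
      unfolding col colored_region_eq_pieces[OF z, of ?c] by (rule measure_UN_pieces) simp
    also have "\<dots> = (\<Sum>k\<le>m1 + m2. if ?c k = a then ?D k else 0)"
      by (subst sum.inter_filter[symmetric]) auto
    finally show ?thesis .
  qed
  have "?m Plus + ?m Minus = (\<Sum>k\<le>m1 + m2. ?D k)"
    unfolding m sum.distrib[symmetric] by (intro sum.cong) auto
  also have "\<dots> = measure N (\<Union>k\<le>m1 + m2. piece m1 z k)"
    by (rule measure_UN_pieces[symmetric]) simp
  also have "\<dots> = 1"
    using UN_piece[OF z] unit_square by simp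
  finally have sum: "?m Plus + ?m Minus = 1" .
  \<comment> \<open>A piece with \<open>z k = 0\<close> is coloured \<open>Plus\<close> by default
    but has sign 0; the two sides agree because it is null.\<close>
  have "?m Plus - ?m Minus = (\<Sum>k\<le>m1 + m2. sgn (z k) * ?D k)"
    unfolding m sum_subtractf[symmetric]
    by (intro sum.cong) (auto simp: sgn_if measure_piece_eq_0)
  then have "?m Plus = ?m Minus"
    using zero by simp
  then show ?thesis
    using sum by (cases a) auto
qed

end

theorem theorem4:
  fixes n m1 m2 :: nat and \<mu> :: "nat \<Rightarrow> (real \<times> real) measure"
  assumes "\<And>i. i \<in> {1..n} \<Longrightarrow> continuous_prob_measure (\<mu> i)"
    and "m1 + m2 = n"
  shows "\<exists>(x :: nat \<Rightarrow> real) (y :: nat \<Rightarrow> real) (col :: nat \<times> nat \<Rightarrow> color).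
           cut_points m1 x \<and> cut_points m2 y \<and>
           (\<forall>i \<in> {1..n}.
              measure (\<mu> i) (colored_region m1 m2 x y col Plus) = 1 / 2 \<and>
              measure (\<mu> i) (colored_region m1 m2 x y col Minus) = 1 / 2)"
proof -
  define N where "N i = distr (\<mu> i) borel id" for i
  have N: "line_null_prob (N i)" if "i \<in> {1..n}" for i
    unfolding N_def using continuous_prob_measure_distr(1)[OF assms(1)[OF that]] .
  \<comment> \<open>This is the measure of the positive region minus that of the negative one. The
    shift by \<open>Suc\<close> translates between measures indexed from 1 and functions indexed
    from 0.\<close>
  define F where "F i z = (\<Sum>k\<le>n. sgn (z k) * measure (N (Suc i)) (piece m1 z k))" for i and z :: "nat \<Rightarrow> real"
  have cont: "continuous_on (octa n) (F i)" if "i < n" for i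
  proof -
    interpret line_null_prob "N (Suc i)"
      using N that by simp
    show ?thesis
      unfolding F_def
      by (intro continuous_on_sum continuous_on_sgn_mult continuous_on_measure_piece measure_piece_eq_0
          continuous_on_subset[OF continuous_on_product_coordinates]) auto
  qed
  \<comment> \<open>The pieces depend only on absolute values; the antipodal map just exchanges the
    colours.\<close>
  have odd: "F i (antipode z) = - F i z" for i z
    by (simp add: F_def sgn_minus sum_negf)
  obtain z where z: "z \<in> octa n" "\<And>i. i < n \<Longrightarrow> F i z = 0"
    using Borsuk_Ulam_octa[of n F] cont odd by blast
  define col where "col = (\<lambda>(i, j). if 0 \<le> z (if j = 0 then i else m1 + j) then Plus else Minus)"
  let ?A = "colored_region m1 m2 (xcut m1 z) (ycut m1 z) col"
  have zm: "z \<in> octa (m1 + m2)" using z assms(2) by simp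
  have "measure (\<mu> i) (?A a) = 1 / 2" if i: "i \<in> {1..n}" for i a
  proof -
    interpret line_null_prob "N i"
      using N[OF i] .
    \<comment> \<open>As a finite union of pieces the region is Borel and lies in the square, so
      \<open>N i\<close> and the original measure agree on it.\<close>
    have A: "?A a = (\<Union>k\<in>{k. k \<le> m1 + m2 \<and> (if 0 \<le> z k then Plus else Minus) = a}. piece m1 z k)"
      unfolding col_def using colored_region_eq_pieces[OF zm] .
    have "?A a \<in> sets borel"
      unfolding A using piece_in_sets by (intro sets.finite_UN) auto
    moreover have "?A a \<subseteq> unit_square"
      unfolding A UN_piece[OF zm le_add1, symmetric] by blast
    ultimately have "measure (\<mu> i) (?A a) = measure (N i) (?A a)"
      using continuous_prob_measure_distr(2)[OF assms(1)[OF i]] by (simp add: N_def)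
    also have "\<dots> = 1 / 2"
      unfolding col_def using z(2)[of "i - 1"] i assms(2) by (intro measure_colored_region_eq_half zm) (auto simp: F_def)
    finally show ?thesis .
  qed
  then show ?thesis
    using cut_points_xcut[of m1 z] cut_points_ycut[OF zm] by blast
qed

end
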